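(* Let $\psi=\langle n_0^{\alpha_0}\rangle\top\wedge\cdots\wedge\langle n_k^{\alpha_k}\rangle\top\in\mathrm{MNF}$. Then there is an ordinal worm $A\in\mathrm{INF}$ such that $\psi\equiv A$ in $\mathbf{TSC}$ and $A=\langle n_0^{\beta_0}\rangle\cdots\langle n_k^{\beta_k}\rangle\top$, where $\beta_k=\alpha_k$ and, for all $0\le i<k$, $\beta_i=-1+\frac{\alpha_i}{e^{n_{i+1}-n_i}(\alpha_{i+1})}$, i.e. $\beta_i$ is the unique ordinal with $\alpha_i=e^{n_{i+1}-n_i}(\alpha_{i+1})\cdot(1+\beta_i)$.
   Context: Ordinals range below $\varepsilon_0$. $\mathbb{F}_{\varepsilon_0}$ is the least set containing $\top$, closed under $\wedge$ and under unary modalities $\langle n^\alpha\rangle$ ($n<\omega$, $\alpha<\varepsilon_0$); $\langle n^0\rangle\varphi$ denotes $\varphi$. An ordinal worm is a formula $\langle m_0^{\gamma_0}\rangle\cdots\langle m_j^{\gamma_j}\rangle\top$ (including $\top$). INF (increasing normal forms): $\top$ and worms built by prefixing $\langle n^\alpha\rangle$ with $0<\alpha$ to a worm in INF whose first modality $\langle m^\beta\rangle$ has $n<m$ (so the bases strictly increase from left to right). Hyper-exponentials: $e^0=\mathrm{id}$, $e^1(\alpha)=-1+\omega^\alpha$, $e^{n+m}=e^n\circ e^m$. MNF is the least set with: $\top\in$ MNF; each monomial $\langle n^\alpha\rangle\top\in$ MNF; if $\langle n_0^{\alpha_0}\rangle\top\wedge\cdots\wedge\langle n_k^{\alpha_k}\rangle\top\in$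 MNF, $n<n_0$, and $\alpha=e^{n_0-n}(\alpha_0)\cdot(2+\beta)$ for some $\beta<\varepsilon_0$, then $\langle n^\alpha\rangle\top\wedge\langle n_0^{\alpha_0}\rangle\top\wedge\cdots\wedge\langle n_k^{\alpha_k}\rangle\top\in$ MNF. $\mathbf{TSC}$ derives sequents $\varphi\vdash\psi$; $\varphi\equiv\psi$ means both directions derivable. Axioms: $\varphi\vdash\varphi$; $\varphi\vdash\top$; $\varphi\wedge\psi\vdash\varphi$; $\varphi\wedge\psi\vdash\psi$; $\langle n^\alpha\rangle\varphi\vdash\langle n^\beta\rangle\varphi$ for $\beta\le\alpha$; $\langle n^{\alpha+\beta}\rangle\varphi\equiv\langle n^\beta\rangle\langle n^\alpha\rangle\varphi$; $\langle(m+n)^\alpha\rangle\varphi\vdash\langle m^{e^n(\alpha)}\rangle\varphi$; Schmerl axioms $\langle n^\alpha\rangle(\langle n_0^{\alpha_0}\rangle\top\wedge\cdots\wedge\langle n_k^{\alpha_k}\rangle\top)\equiv\langle n^{e^{n_0-n}(\alpha_0)\cdot(1+\alpha)}\rangle\top\wedge\langle n_0^{\alpha_0}\rangle\top\wedge\cdots\wedge\langle n_k^{\alpha_k}\rangle\top$ for $n<n_0$ and the conjunction in MNF. Rules: from $\varphi\vdash\psi$, $\varphi\vdash\chi$ infer $\varphi\vdash\psi\wedge\chi$; from $\varphi\vdash\psi$, $\psi\vdash\chi$ infer $\varphi\vdash\chi$; from $\varphi\vdash\psi$ infer $\langle n^\alpha\rangle\varphi\vdash\langle n^\alpha\rangle\psi$;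 from $\varphi\vdash\psi$ infer $\langle n^\alpha\rangle\varphi\wedge\langle m^{\beta+1}\rangle\psi\vdash\langle n^\alpha\rangle(\varphi\wedge\langle m^{\beta+1}\rangle\psi)$ for $m<n$. *)

theory Defs
  imports Main
begin

section \<open>The ordinals below \<open>\<epsilon>\<^sub>0\<close>\<close>

text \<open>
  Ordinals below \<open>\<epsilon>\<^sub>0\<close> are represented by Cantor normal forms: \<open>CAdd a b\<close> stands for
  \<open>\<omega>\<^sup>a + b\<close>. The lemmas \<open>eps0_plus_rec\<close>, \<open>eps0_times_rec\<close>, \<open>omega_pow_rec\<close> below show that the
  operations satisfy the usual transfinite recursions (with \<open>omega_pow 1\<close> equal to \<open>\<omega>\<close> by
  \<open>less_omega_iff\<close>), and \<open>eps0_below_tower\<close> and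
  \<open>eps0_less_omega_pow\<close> that the order type is exactly \<open>\<epsilon>\<^sub>0\<close>.
\<close>

datatype cnf = CZero | CAdd cnf cnf

fun cless :: "cnf \<Rightarrow> cnf \<Rightarrow> bool" where
  "cless x CZero = False"
| "cless CZero (CAdd c d) = True"
| "cless (CAdd a b) (CAdd c d) = (cless a c \<or> a = c \<and> cless b d)"

fun lead_le :: "cnf \<Rightarrow> cnf \<Rightarrow> bool" where
  "lead_le CZero a = True"
| "lead_le (CAdd c d) a = (\<not> cless a c)"

fun nf :: "cnf \<Rightarrow> bool" where
  "nf CZero = True"
| "nf (CAdd a b) = (nf a \<and> nf b \<and> lead_le b a)"

fun cadd :: "cnf \<Rightarrow> cnf \<Rightarrow> cnf" where
  "cadd CZero y = y"
| "cadd (CAdd a b) CZero = CAdd a b"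
| "cadd (CAdd a b) (CAdd c d) = (if cless a c then CAdd c d else CAdd a (cadd b (CAdd c d)))"

text \<open>For \<open>x = \<omega>\<^sup>a + b\<close> one has \<open>x \<cdot> \<omega>\<^sup>0 = x\<close>, and \<open>x \<cdot> \<omega>\<^sup>c = \<omega>\<^bsup>a+c\<^esup>\<close> when \<open>c > 0\<close>;
  multiplication distributes over sums in its right argument.\<close>

fun cmul_pow :: "cnf \<Rightarrow> cnf \<Rightarrow> cnf" where
  "cmul_pow CZero c = CZero"
| "cmul_pow (CAdd a b) c = (if c = CZero then CAdd a b else CAdd (cadd a c) CZero)"

fun cmul :: "cnf \<Rightarrow> cnf \<Rightarrow> cnf" where
  "cmul x CZero = CZero"
| "cmul x (CAdd c d) = cadd (cmul_pow x c) (cmul x d)"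

lemma cless_irrefl [simp]: "\<not> cless x x"
  by (induction x) auto

lemma cless_trans: "cless x y \<Longrightarrow> cless y z \<Longrightarrow> cless x z"
proof (induction y arbitrary: x z)
  case CZero then show ?case by simp
next
  case (CAdd a b)
  show ?case
  proof (cases x)
    case CZero then show ?thesis using CAdd.prems(2) by (cases z) auto
  next
    case x: (CAdd c d)
    then obtain e f where z: "z = CAdd e f" using CAdd.prems(2) by (cases z) auto
    have "cless c a \<or> c = a \<and> cless d b" "cless a e \<or> a = e \<and> cless b f"
      using CAdd.prems x z by auto
    then show ?thesis using CAdd.IH(1)[of c e] CAdd.IH(2)[of d f] x z by auto
  qed
qed

lemma cless_total: "cless x y \<or> x = y \<or> cless y x"
proof (induction x arbitrary: y)
  case CZero then show ?case by (cases y) auto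
next
  case (CAdd a b) then show ?case by (cases y) auto
qed

lemma cless_asym: "cless x y \<Longrightarrow> \<not> cless y x"
  using cless_trans cless_irrefl by blast

lemma not_cless_trans: "\<not> cless y x \<Longrightarrow> \<not> cless z y \<Longrightarrow> \<not> cless z x"
  by (metis cless_total cless_trans)

lemma cle_cless_trans: "\<not> cless y x \<Longrightarrow> cless y z \<Longrightarrow> cless x z"
  by (metis cless_total cless_trans)

lemma CZero_cless [simp]: "cless CZero x \<longleftrightarrow> x \<noteq> CZero"
  by (cases x) auto

lemma lead_le_cless: "lead_le b a \<Longrightarrow> nf b \<Longrightarrow> nf a \<Longrightarrow> cless b (CAdd a b)"
proof (induction b arbitrary: a)
  case CZero then show ?case by simp
next
  case (CAdd c d)
  then show ?case using cless_total[of c a] by auto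
qed

definition cnf_rel :: "(cnf \<times> cnf) set" where
  "cnf_rel = {(x, y). nf x \<and> nf y \<and> cless x y}"

lemma acc_CAdd:
  assumes "a \<in> Wellfounded.acc cnf_rel" "nf a"
  shows "b \<in> Wellfounded.acc cnf_rel \<Longrightarrow> nf (CAdd a b) \<Longrightarrow> CAdd a b \<in> Wellfounded.acc cnf_rel"
  using assms
proof (induction a arbitrary: b rule: acc_induct_rule)
  case (1 a)
  note IHa = 1(2)
  from \<open>b \<in> Wellfounded.acc cnf_rel\<close> \<open>nf (CAdd a b)\<close> show ?case
  proof (induction b rule: acc_induct_rule)
    case (1 b)
    have "y \<in> Wellfounded.acc cnf_rel" if "nf y" "cless y (CAdd a b)" for y
      using that
    proof (induction y)
      case CZero
      show ?case by (rule accI) (auto simp: cnf_rel_def)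
    next
      case (CAdd c d)
      consider "cless c a" | "c = a" "cless d b" using CAdd.prems by auto
      then show ?case
      proof cases
        case 1
        have "cless d (CAdd a b)"
        proof (cases d)
          case CZero then show ?thesis by simp
        next
          case (CAdd g h)
          then have "cless g a" using \<open>nf (CAdd c d)\<close> 1 cle_cless_trans[of c g a] by simp
          then show ?thesis using CAdd by simp
        qed
        then have "d \<in> Wellfounded.acc cnf_rel" using CAdd by auto
        then show ?thesis
          using IHa[of c d] 1 CAdd.prems \<open>nf a\<close> by (auto simp: cnf_rel_def)
      next
        case 2
        then have "(d, b) \<in> cnf_rel"
          using CAdd.prems \<open>nf (CAdd a b)\<close> by (auto simp: cnf_rel_def)
        then show ?thesis using "1.IH" CAdd.prems 2 by auto
      qed
    qed
    then show ?case
      by (rule accI) (auto simp: cnf_rel_def)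
  qed
qed

lemma nf_acc: "nf x \<Longrightarrow> x \<in> Wellfounded.acc cnf_rel"
proof (induction x)
  case CZero
  show ?case by (rule accI) (auto simp: cnf_rel_def)
next
  case (CAdd a b) then show ?case using acc_CAdd by auto
qed

lemma lead_le_cadd: "lead_le x a \<Longrightarrow> lead_le y a \<Longrightarrow> lead_le (cadd x y) a"
  by (cases "(x, y)" rule: cadd.cases) auto

lemma nf_cadd: "nf x \<Longrightarrow> nf y \<Longrightarrow> nf (cadd x y)"
  by (induction x y rule: cadd.induct) (auto simp: lead_le_cadd)

lemma cadd_CZero_right [simp]: "cadd x CZero = x"
  by (cases x) auto

lemma lead_absorb: "lead_le b a \<Longrightarrow> cless a c \<Longrightarrow> cadd b (CAdd c d) = CAdd c d"
proof (cases b)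
  case (CAdd e f)
  assume "lead_le b a" "cless a c"
  then have "cless e c" using CAdd cle_cless_trans[of a e c] by simp
  then show ?thesis using CAdd by simp
qed simp

lemma cadd_assoc: "nf x \<Longrightarrow> nf y \<Longrightarrow> nf z \<Longrightarrow> cadd (cadd x y) z = cadd x (cadd y z)"
proof (induction x)
  case CZero then show ?case by simp
next
  case (CAdd a b)
  show ?case
  proof (cases y)
    case CZero then show ?thesis by simp
  next
    case y: (CAdd c d)
    show ?thesis
    proof (cases z)
      case CZero then show ?thesis by simp
    next
      case z: (CAdd e f)
      show ?thesis
        using CAdd y z lead_absorb[of b a e f]
        by (auto dest: cless_trans not_cless_trans)
    qed
  qed
qed

lemma cadd_mono_right: "nf x \<Longrightarrow> nf y \<Longrightarrow> nf z \<Longrightarrow> cless y z \<Longrightarrow> cless (cadd x y) (cadd x z)"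
proof (induction x)
  case CZero then show ?case by simp
next
  case (CAdd a b)
  show ?case
  proof (cases z)
    case CZero then show ?thesis using CAdd by simp
  next
    case z: (CAdd e f)
    show ?thesis
    proof (cases y)
      case CZero
      then show ?thesis using CAdd z by (cases "cless a e") auto
    next
      case y: (CAdd c d)
      then show ?thesis using CAdd z cless_total[of a e] by (auto dest: cless_trans)
    qed
  qed
qed

lemma cadd_diff: "nf x \<Longrightarrow> nf y \<Longrightarrow> \<not> cless y x \<Longrightarrow> \<exists>z. nf z \<and> cadd x z = y"
proof (induction x arbitrary: y)
  case CZero then show ?case by auto
next
  case (CAdd a b)
  then obtain c d where y: "y = CAdd c d" by (cases y) auto
  show ?case
  proof (cases "cless a c")
    case True
    then show ?thesis using y CAdd.prems by (intro exI[of _ y]) auto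
  next
    case False
    then have c: "c = a" and "\<not> cless d b" using CAdd.prems y cless_total[of a c] by auto
    then obtain z where z: "nf z" "cadd b z = d" using CAdd y by auto
    show ?thesis
    proof (cases z)
      case CZero then show ?thesis using z c y by (intro exI[of _ z]) auto
    next
      case zz: (CAdd e f)
      have "\<not> cless a e"
      proof
        assume "cless a e"
        moreover then have "d = CAdd e f"
          using z zz CAdd.prems lead_absorb[of b a e f] by auto
        ultimately show False using CAdd.prems y c by auto
      qed
      then show ?thesis using z zz c y by (intro exI[of _ z]) auto
    qed
  qed
qed

lemma nf_cmul_pow: "nf x \<Longrightarrow> nf c \<Longrightarrow> nf (cmul_pow x c)"
  by (cases x) (auto simp: nf_cadd)

lemma nf_cmul: "nf x \<Longrightarrow> nf y \<Longrightarrow> nf (cmul x y)"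
  by (induction y) (auto simp: nf_cadd nf_cmul_pow)

lemma cmul_CZero_left: "cmul CZero y = CZero"
  by (induction y) auto

lemma cmul_pow_absorb:
  assumes "nf x" "nf e" "nf f" "cless e f" "nf r"
  shows "cadd (cmul_pow x e) (cadd (cmul_pow x f) r) = cadd (cmul_pow x f) r"
proof (cases x)
  case CZero then show ?thesis by simp
next
  case (CAdd a b)
  have f: "f \<noteq> CZero" using assms by auto
  have "cless (cadd a e) (cadd a f)" using assms CAdd by (auto intro: cadd_mono_right)
  then have "cadd (cmul_pow x e) (cmul_pow x f) = cmul_pow x f"
    using CAdd f assms by (cases "e = CZero") auto
  then show ?thesis using assms by (metis cadd_assoc nf_cmul_pow)
qed

lemma cmul_absorb:
  assumes "nf x" "nf (CAdd f d)" "cless e f" "nf e"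
  shows "nf y \<Longrightarrow> lead_le y e \<Longrightarrow> cadd (cmul x y) (cmul x (CAdd f d)) = cmul x (CAdd f d)"
proof (induction y)
  case CZero then show ?case by simp
next
  case (CAdd g h)
  have gf: "cless g f" using CAdd.prems assms by (metis cless_total cless_trans lead_le.simps(2))
  have "lead_le h e" using CAdd.prems by (cases h) (auto dest: not_cless_trans)
  then have IH: "cadd (cmul x h) (cmul x (CAdd f d)) = cmul x (CAdd f d)" using CAdd by auto
  have "cadd (cmul x (CAdd g h)) (cmul x (CAdd f d))
      = cadd (cmul_pow x g) (cadd (cmul x h) (cmul x (CAdd f d)))"
    using assms CAdd.prems by (simp add: cadd_assoc nf_cmul nf_cmul_pow nf_cadd)
  also have "\<dots> = cmul x (CAdd f d)"
    unfolding IH using assms CAdd.prems gf by (simp add: cmul_pow_absorb nf_cmul)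
  finally show ?case .
qed

lemma cmul_distrib: "nf x \<Longrightarrow> nf y \<Longrightarrow> nf z \<Longrightarrow> cmul x (cadd y z) = cadd (cmul x y) (cmul x z)"
proof (induction y)
  case CZero then show ?case by simp
next
  case (CAdd e b)
  show ?case
  proof (cases z)
    case CZero then show ?thesis by simp
  next
    case z: (CAdd f d)
    show ?thesis
    proof (cases "cless e f")
      case True
      then show ?thesis using cmul_absorb[of x f d e "CAdd e b"] CAdd.prems z by auto
    next
      case False
      then show ?thesis using CAdd z
        by (simp add: cadd_assoc nf_cmul nf_cmul_pow nf_cadd del: cmul.simps(2)) 
          (simp add: cadd_assoc nf_cmul nf_cmul_pow nf_cadd)
    qed
  qed
qed

typedef eps0 = "{x. nf x}" morphisms cnf_of Abs_eps0
  by (rule exI[of _ CZero]) simp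

setup_lifting type_definition_eps0

instantiation eps0 :: "{zero, one, plus, times, ord}"
begin
lift_definition zero_eps0 :: eps0 is CZero by simp
lift_definition one_eps0 :: eps0 is "CAdd CZero CZero" by simp
lift_definition plus_eps0 :: "eps0 \<Rightarrow> eps0 \<Rightarrow> eps0" is cadd by (rule nf_cadd)
lift_definition times_eps0 :: "eps0 \<Rightarrow> eps0 \<Rightarrow> eps0" is cmul by (rule nf_cmul)
lift_definition less_eps0 :: "eps0 \<Rightarrow> eps0 \<Rightarrow> bool" is cless .
lift_definition less_eq_eps0 :: "eps0 \<Rightarrow> eps0 \<Rightarrow> bool" is "\<lambda>x y. cless x y \<or> x = y" .
instance ..
end

lift_definition omega_pow :: "eps0 \<Rightarrow> eps0" is "\<lambda>a. CAdd a CZero" by simp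

instance eps0 :: wellorder
proof (rule wf_wellorderI)
  have "x \<in> Wellfounded.acc cnf_rel" for x
  proof (cases "nf x")
    case False
    then show ?thesis by - (rule accI, simp add: cnf_rel_def)
  qed (rule nf_acc)
  then have "wf cnf_rel" by (simp add: acc_wfI)
  then have "wf (inv_image cnf_rel cnf_of)" by (rule wf_inv_image)
  moreover have "{(x::eps0, y). x < y} \<subseteq> inv_image cnf_rel cnf_of"
    using cnf_of by (auto simp: cnf_rel_def less_eps0.rep_eq)
  ultimately show "wf {(x::eps0, y). x < y}" by (rule wf_subset)
  show "OFCLASS(eps0, linorder_class)"
    by standard (transfer; use cless_asym cless_trans cless_total in blast)+
qed

instance eps0 :: monoid_add
  by standard (transfer; simp add: cadd_assoc)+

instance eps0 :: numeral ..

lemma eps0_zero_le [simp]: "(0::eps0) \<le> x"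
  by transfer auto

lemma eps0_cases:
  obtains "x = (0::eps0)" | a b where "x = omega_pow a + b" "b < x" "x < omega_pow (a + 1)"
proof (cases "x = 0")
  case False
  have "\<exists>a b. x = omega_pow a + b \<and> b < x \<and> x < omega_pow (a + 1)"
    using False
  proof transfer
    fix x assume "nf x" "x \<noteq> CZero"
    then obtain a b where x: "x = CAdd a b" "nf a" "nf b" "lead_le b a" by (cases x) auto
    have "cadd (CAdd a CZero) b = x" using x by (cases b) auto
    moreover have "cless b x" using x lead_le_cless by auto
    moreover have "cless a (cadd a (CAdd CZero CZero))"
      using cadd_mono_right[of a CZero "CAdd CZero CZero"] x by auto
    ultimately show "\<exists>a\<in>{x. nf x}. \<exists>b\<in>{x. nf x}. x = cadd (CAdd a CZero) b \<and> cless b x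
        \<and> cless x (CAdd (cadd a (CAdd CZero CZero)) CZero)"
      using x by - (rule bexI[of _ a], rule bexI[of _ b], simp_all)
  qed
  then show ?thesis using that by blast
qed (use that in blast)

lemma eps0_add_less_cancel [simp]: "(a::eps0) + b < a + c \<longleftrightarrow> b < c"
proof -
  have "b < c \<Longrightarrow> a + b < a + c" for b c :: eps0 by transfer (rule cadd_mono_right)
  then show ?thesis by (metis less_imp_not_less linorder_less_linear)
qed

lemma eps0_add_le_cancel [simp]: "(a::eps0) + b \<le> a + c \<longleftrightarrow> b \<le> c"
  by (simp flip: not_less)

lemma eps0_add_left_cancel [simp]: "(a::eps0) + b = a + c \<longleftrightarrow> b = c"
  by (simp add: order.eq_iff)

lemma eps0_le_add [simp]: "(a::eps0) \<le> a + b"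
  using eps0_add_le_cancel[of a 0 b] by simp

lemma eps0_le_iff_add: "(a::eps0) \<le> b \<longleftrightarrow> (\<exists>c. b = a + c)"
proof
  assume "a \<le> b"
  then have "\<not> b < a" by simp
  then show "\<exists>c. b = a + c" by transfer (use cadd_diff in force)
qed auto

lemma eps0_zero_less_one [simp]: "(0::eps0) < 1"
  by transfer simp

lemma eps0_less_one: "x < (1::eps0) \<Longrightarrow> x = 0"
proof transfer
  show "cless x (CAdd CZero CZero) \<Longrightarrow> x = CZero" for x by (cases x) auto
qed

lemma eps0_less_add_one_iff: "(a::eps0) < b + 1 \<longleftrightarrow> a \<le> b"
proof
  assume *: "a < b + 1"
  show "a \<le> b"
  proof (rule ccontr)
    assume "\<not> a \<le> b"
    then obtain c where "a = b + c" using eps0_le_iff_add[of b a] by auto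
    with * have "c < 1" by simp
    then have "c = 0" by (rule eps0_less_one)
    then show False using \<open>a = b + c\<close> \<open>\<not> a \<le> b\<close> by simp
  qed
next
  assume "a \<le> b"
  moreover have "b < b + 1" using eps0_add_less_cancel[of b 0 1] by simp
  ultimately show "a < b + 1" by simp
qed

lemma eps0_times_zero [simp]: "(a::eps0) * 0 = 0"
  by transfer simp

lemma eps0_zero_times [simp]: "(0::eps0) * a = 0"
  by transfer (simp add: cmul_CZero_left)

lemma eps0_times_one [simp]: "(a::eps0) * 1 = a"
  by transfer (case_tac a; simp)

lemma eps0_distrib_left: "(a::eps0) * (b + c) = a * b + a * c"
  by transfer (rule cmul_distrib)

lemma eps0_times_pos: "0 < a \<Longrightarrow> 0 < b \<Longrightarrow> (0::eps0) < a * b"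
proof transfer
  fix a b assume "nf a" "nf b" "cless CZero a" "cless CZero b"
  then show "cless CZero (cmul a b)"
    by (cases a; cases b) (auto, (metis cadd.simps cnf.distinct(1) cnf.exhaust)+)
qed

lemma eps0_times_less_cancel: "0 < a \<Longrightarrow> (a::eps0) * b < a * c \<longleftrightarrow> b < c"
proof -
  assume a: "0 < a"
  have "a * b < a * c" if bc: "b < c" for b c :: eps0
  proof -
    obtain d where d: "c = b + d" using bc eps0_le_iff_add[of b c] by auto
    with bc have "0 < d" using eps0_add_less_cancel[of b 0 d] by simp
    with a have "0 < a * d" by (rule eps0_times_pos)
    then show ?thesis using eps0_add_less_cancel[of "a * b" 0 "a * d"]
      by (simp add: d eps0_distrib_left)
  qed
  then show ?thesis by (metis less_imp_not_less linorder_less_linear)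
qed

lemma eps0_times_left_cancel: "0 < a \<Longrightarrow> (a::eps0) * b = a * c \<longleftrightarrow> b = c"
  by (metis eps0_times_less_cancel less_irrefl linorder_less_linear)

lemma omega_pow_0 [simp]: "omega_pow 0 = 1"
  by transfer simp

lemma omega_pow_less_iff [simp]: "omega_pow a < omega_pow b \<longleftrightarrow> a < b"
  by transfer simp

lemma omega_pow_pos [simp]: "0 < omega_pow a"
  by transfer simp

lemma omega_pow_add: "omega_pow (a + b) = omega_pow a * omega_pow b"
  by transfer (case_tac "b = CZero"; simp)

lemma times_omega_pow:
  assumes "0 < b" "r < omega_pow (a + 1)"
  shows "(omega_pow a + r) * omega_pow b = omega_pow (a + b)"
  using assms
proof transfer
  fix b r a
  assume *: "nf b" "nf r" "nf a" "cless CZero b"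
    "cless r (CAdd (cadd a (CAdd CZero CZero)) CZero)"
  obtain s where s: "cadd (CAdd a CZero) r = CAdd a s" if "\<not> (\<exists>c d. r = CAdd c d \<and> cless a c)"
    by (cases r) auto
  have "\<not> (cless a c)" if r: "r = CAdd c d" for c d
  proof
    assume "cless a c"
    then have "\<not> cless c (cadd a (CAdd CZero CZero))"
    proof -
      have nc: "nf c" using * r by simp
      obtain z where z: "nf z" "cadd a z = c"
        using cadd_diff[of a c] * nc \<open>cless a c\<close> cless_asym by blast
      with \<open>cless a c\<close> have "z \<noteq> CZero" by auto
      then have "\<not> cless z (CAdd CZero CZero)" by (cases z) auto
      then show ?thesis using z cadd_mono_right[of a "CAdd CZero CZero" z] * cless_total[of z "CAdd CZero CZero"]
        by (auto dest: cless_asym)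
    qed
    then show False using * r by auto
  qed
  then have "cadd (CAdd a CZero) r = CAdd a s" using s by blast
  then show "cmul (cadd (CAdd a CZero) r) (CAdd b CZero) = CAdd (cadd a b) CZero"
    using * by simp
qed

lemma eps0_division:
  assumes "(0::eps0) < a"
  shows "\<exists>q r. c = a * q + r \<and> r < a"
proof (induction c rule: less_induct)
  case (less c)
  obtain p b where a: "a = omega_pow p + b" "b < a" "a < omega_pow (p + 1)"
    using eps0_cases[of a] assms by auto
  show ?case
  proof (cases "c < a")
    case True
    then show ?thesis by (metis add.left_neutral eps0_times_zero)
  next
    case False
    then obtain e d where c: "c = omega_pow e + d" "d < c" "c < omega_pow (e + 1)"
      using eps0_cases[of c] assms by (metis leD leI)
    have "omega_pow p \<le> a" using a eps0_le_add by metis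
    then have "omega_pow p < omega_pow (e + 1)" using False c by (meson leI le_less_trans)
    then have "p \<le> e" by (simp add: eps0_less_add_one_iff)
    show ?thesis
    proof (cases "p = e")
      case False
      with \<open>p \<le> e\<close> obtain f where f: "e = p + f" "0 < f"
        by (metis add.right_neutral eps0_le_iff_add eps0_zero_le order_le_less)
      have "b < omega_pow (p + 1)" using a by simp
      then have "a * omega_pow f = omega_pow e" using a f times_omega_pow by metis
      moreover obtain q r where "d = a * q + r" "r < a" using less c by blast
      ultimately have "c = a * (omega_pow f + q) + r \<and> r < a"
        using c by (simp add: eps0_distrib_left add.assoc)
      then show ?thesis by blast
    next
      case True
      have "b \<le> d" using \<open>\<not> c < a\<close> a c True by (metis eps0_add_le_cancel leI)
      then obtain d' where d': "d = b + d'" using eps0_le_iff_add by blast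
      have "d' < c"
      proof (rule ccontr)
        assume "\<not> d' < c"
        then have "d < d'" using c by simp
        then have "b + d' < d'" using d' by simp
        moreover have "d' \<le> b + d'"
        proof (rule ccontr)
          assume *: "\<not> d' \<le> b + d'"
          have "\<exists>x. b + x < x" using * by (intro exI[of _ d']) simp
          then have "b + (LEAST x. b + x < x) < (LEAST x. b + x < x)"
            by (rule LeastI_ex)
          moreover then have "b + (b + (LEAST x. b + x < x)) < b + (LEAST x. b + x < x)" by simp
          ultimately show False using not_less_Least by blast
        qed
        ultimately show False by simp
      qed
      then obtain q r where "d' = a * q + r" "r < a" using less by blast
      moreover have "c = a + d'" using c d' a True by (simp add: add.assoc)
      ultimately have "c = a * (1 + q) + r \<and> r < a" by (simp add: eps0_distrib_left add.assoc)
      then show ?thesis by blast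
    qed
  qed
qed

lemma eps0_plus_rec: "(a::eps0) + b = (LEAST c. a \<le> c \<and> (\<forall>b'<b. a + b' < c))"
proof (rule Least_equality[symmetric])
  fix c assume c: "a \<le> c \<and> (\<forall>b'<b. a + b' < c)"
  then obtain d where "c = a + d" using eps0_le_iff_add by blast
  then show "a + b \<le> c" using c by (metis eps0_add_le_cancel leI less_irrefl)
qed simp

lemma eps0_times_rec: "(a::eps0) * b = (LEAST c. \<forall>b'<b. a * b' + a \<le> c)"
proof (cases "a = 0")
  case True then show ?thesis by (simp add: Least_equality)
next
  case False
  then have a: "0 < a" by (simp add: order_less_le)
  show ?thesis
  proof (rule Least_equality[symmetric])
    show "\<forall>b'<b. a * b' + a \<le> a * b"
    proof (intro allI impI)
      fix b' assume "b' < b"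
      then have "b' + 1 \<le> b" by (meson eps0_less_add_one_iff leD leI)
      then have "a * (b' + 1) \<le> a * b" using eps0_times_less_cancel[OF a] by (meson not_less)
      then show "a * b' + a \<le> a * b" by (simp add: eps0_distrib_left)
    qed
  next
    fix c assume c: "\<forall>b'<b. a * b' + a \<le> c"
    obtain q r where q: "c = a * q + r" "r < a" using eps0_division[OF a] by blast
    then have "c < a * q + a" by simp
    then have "\<not> q < b" using c by auto
    then have "a * b \<le> a * q" using eps0_times_less_cancel[OF a] by (meson not_less)
    then show "a * b \<le> c" using q eps0_le_add order.trans by blast
  qed
qed

lemma omega_pow_rec: "omega_pow a = (LEAST c. 0 < c \<and> (\<forall>b<a. omega_pow b * omega_pow 1 \<le> c))"
proof (rule Least_equality[symmetric])
  show "0 < omega_pow a \<and> (\<forall>b<a. omega_pow b * omega_pow 1 \<le> omega_pow a)"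
    by (auto simp flip: omega_pow_add not_less simp: eps0_less_add_one_iff)
next
  fix c assume c: "0 < c \<and> (\<forall>b<a. omega_pow b * omega_pow 1 \<le> c)"
  then obtain e d where e: "c = omega_pow e + d" "c < omega_pow (e + 1)"
    using eps0_cases[of c] by (metis less_irrefl)
  then have "\<not> e < a" using c by (auto simp: omega_pow_add)
  then show "omega_pow a \<le> c"
    using e by (metis eps0_le_add not_less omega_pow_less_iff order.trans)
qed

lemma less_omega_iff: "x < omega_pow 1 \<longleftrightarrow> (\<exists>k. x = ((\<lambda>y. y + 1) ^^ k) 0)"
proof
  assume "x < omega_pow 1"
  then show "\<exists>k. x = ((\<lambda>y. y + 1) ^^ k) 0"
  proof (induction x rule: less_induct)
    case (less x)
    show ?case
    proof (cases x rule: eps0_cases)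
      case 1 then show ?thesis by (intro exI[of _ 0]) simp
    next
      case (2 a b)
      then have "omega_pow a < omega_pow 1" using less.prems by (metis eps0_le_add le_less_trans)
      then have "a = 0" using eps0_less_one by simp
      then have x: "x = 1 + b" using 2 by simp
      obtain k where k: "b = ((\<lambda>y. y + 1) ^^ k) 0" using less 2 by (meson order.strict_trans)
      have "1 + ((\<lambda>y. y + 1) ^^ k) (0::eps0) = ((\<lambda>y. y + 1) ^^ Suc k) 0" for k
        by (induction k) (simp_all flip: add.assoc)
      then show ?thesis using x k by blast
    qed
  qed
next
  assume "\<exists>k. x = ((\<lambda>y. y + 1) ^^ k) 0"
  then obtain k where k: "x = ((\<lambda>y. y + 1) ^^ k) 0" by blast
  have *: "y + 1 < omega_pow 1" if "y < omega_pow 1" for y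
  proof -
    have "1 + omega_pow 1 = omega_pow 1" by transfer simp
    moreover have "y + 1 \<noteq> omega_pow 1"
    proof
      assume eq: "y + 1 = omega_pow 1"
      then have "1 + y + 1 = y + 1" using \<open>1 + omega_pow 1 = omega_pow 1\<close> by (metis add.assoc)
      then have "1 + y = y" by (metis eps0_less_add_one_iff order.eq_iff order.refl)
      have "omega_pow 1 \<le> y"
      proof (cases y rule: eps0_cases)
        case 1 then show ?thesis using \<open>1 + y = y\<close> by simp
      next
        case (2 a b)
        have "\<not> a < 1"
        proof
          assume "a < 1"
          then have "a = 0" using eps0_less_one by simp
          then have "y = 1 + b" using 2 by simp
          then show False using \<open>1 + y = y\<close> 2 by (metis eps0_add_left_cancel less_irrefl)
        qed
        then show ?thesis using 2 by (metis eps0_le_add not_less omega_pow_less_iff order.trans)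
      qed
      then show False using that by simp
    qed
    moreover have "y + 1 \<le> omega_pow 1"
      using that by (meson eps0_less_add_one_iff leD leI)
    ultimately show ?thesis by simp
  qed
  show "x < omega_pow 1" unfolding k by (induction k) (use * in auto)
qed

lemma eps0_less_omega_pow: "a < omega_pow a"
proof transfer
  show "nf a \<Longrightarrow> cless a (CAdd a CZero)" for a
  proof (induction a)
    case (CAdd b c)
    then have "cless b (CAdd b CZero)" by simp
    moreover have "cless (CAdd b CZero) (CAdd b c) \<or> c = CZero" by simp
    ultimately have "cless b (CAdd b c)" using cless_trans by blast
    then show ?case by simp
  qed simp
qed

lemma eps0_below_tower: "\<exists>k. a < (omega_pow ^^ k) 0"
proof -
  have "\<exists>k. cless x (cnf_of ((omega_pow ^^ k) 0))" if "nf x" for x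
    using that
  proof (induction x)
    case CZero
    show ?case by (rule exI[of _ 1]) (simp add: one_eps0.rep_eq)
  next
    case (CAdd b c)
    then obtain k where "cless b (cnf_of ((omega_pow ^^ k) 0))" by auto
    then show ?case by (intro exI[of _ "Suc k"]) (simp add: omega_pow.rep_eq)
  qed
  then show ?thesis using cnf_of[of a] by (simp add: less_eps0.rep_eq)
qed

text \<open>\<open>lsub a b\<close> is the left difference \<open>-a + b\<close>, meaningful for \<open>a \<le> b\<close>;
  \<open>lquot a d\<close> is the exact quotient \<open>a / d\<close>, meaningful if \<open>0 < d\<close> divides \<open>a\<close> on the left.\<close>

definition lsub :: "eps0 \<Rightarrow> eps0 \<Rightarrow> eps0" where
  "lsub a b = (THE c. a + c = b)"

definition lquot :: "eps0 \<Rightarrow> eps0 \<Rightarrow> eps0" where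
  "lquot a d = (THE c. a = d * c)"

definition hyper_exp :: "nat \<Rightarrow> eps0 \<Rightarrow> eps0" where
  "hyper_exp n = (\<lambda>a. lsub 1 (omega_pow a)) ^^ n"


section \<open>Formulas, worms and normal forms\<close>

datatype fm = Top | Conj fm fm | Dia nat eps0 fm

text \<open>\<open>\<langle>n\<^sup>0\<rangle>\<phi>\<close> is the formula \<open>\<phi>\<close> itself, so the modality \<open>\<langle>n\<^sup>\<alpha>\<rangle>\<phi>\<close> is \<open>dia n \<alpha> \<phi>\<close>; the constructor
  \<open>Dia\<close> never occurs with exponent \<open>0\<close> in a member of \<open>formulas\<close>.\<close>

definition dia :: "nat \<Rightarrow> eps0 \<Rightarrow> fm \<Rightarrow> fm" where
  "dia n \<alpha> \<phi> = (if \<alpha> = 0 then \<phi> else Dia n \<alpha> \<phi>)"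

inductive_set formulas :: "fm set" where
  Top: "Top \<in> formulas"
| Conj: "\<phi> \<in> formulas \<Longrightarrow> \<psi> \<in> formulas \<Longrightarrow> Conj \<phi> \<psi> \<in> formulas"
| dia: "\<phi> \<in> formulas \<Longrightarrow> dia n \<alpha> \<phi> \<in> formulas"

fun worm_of :: "(nat \<times> eps0) list \<Rightarrow> fm" where
  "worm_of [] = Top"
| "worm_of ((n, \<alpha>) # l) = dia n \<alpha> (worm_of l)"

definition worms :: "fm set" where
  "worms = range worm_of"

inductive_set INF_worms :: "fm set" where
  Top: "Top \<in> INF_worms"
| single: "0 < \<alpha> \<Longrightarrow> dia n \<alpha> Top \<in> INF_worms"
| step: "dia m \<beta> A \<in> INF_worms \<Longrightarrow> 0 < \<beta> \<Longrightarrow> 0 < \<alpha> \<Longrightarrow> n < m \<Longrightarrow> dia n \<alpha> (dia m \<beta> A) \<in> INF_worms"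

fun mconj :: "(nat \<times> eps0) list \<Rightarrow> fm" where
  "mconj [] = Top"
| "mconj [(n, \<alpha>)] = dia n \<alpha> Top"
| "mconj ((n, \<alpha>) # p # l) = Conj (dia n \<alpha> Top) (mconj (p # l))"

text \<open>A monomial proper has a positive exponent, since \<open>\<langle>n\<^sup>0\<rangle>\<top>\<close> is \<open>\<top>\<close>. The condition \<open>0 < \<alpha>\<^sub>0\<close> in the
  rule \<open>step\<close> (and in the Schmerl axioms below) only prevents \<open>\<top>\<close> from being read as the
  monomial \<open>\<langle>n\<^sub>0\<^sup>0\<rangle>\<top>\<close>; the Schmerl axiom would then make \<open>\<langle>n\<^sup>\<alpha>\<rangle>\<top>\<close> derivable.\<close>

inductive_set MNF :: "fm set" where
  Top: "Top \<in> MNF"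
| monomial: "0 < \<alpha> \<Longrightarrow> dia n \<alpha> Top \<in> MNF"
| step: "mconj ((n\<^sub>0, \<alpha>\<^sub>0) # l) \<in> MNF \<Longrightarrow> 0 < \<alpha>\<^sub>0 \<Longrightarrow> n < n\<^sub>0 \<Longrightarrow>
    \<alpha> = hyper_exp (n\<^sub>0 - n) \<alpha>\<^sub>0 * (2 + \<beta>) \<Longrightarrow>
    mconj ((n, \<alpha>) # (n\<^sub>0, \<alpha>\<^sub>0) # l) \<in> MNF"


section \<open>The calculus \<open>TSC\<close>\<close>

inductive TSC :: "fm \<Rightarrow> fm \<Rightarrow> bool" (infix "\<turnstile>" 50) where
  refl: "\<phi> \<in> formulas \<Longrightarrow> \<phi> \<turnstile> \<phi>"
| top: "\<phi> \<in> formulas \<Longrightarrow> \<phi> \<turnstile> Top"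
| conj1: "\<phi> \<in> formulas \<Longrightarrow> \<psi> \<in> formulas \<Longrightarrow> Conj \<phi> \<psi> \<turnstile> \<phi>"
| conj2: "\<phi> \<in> formulas \<Longrightarrow> \<psi> \<in> formulas \<Longrightarrow> Conj \<phi> \<psi> \<turnstile> \<psi>"
| mono: "\<phi> \<in> formulas \<Longrightarrow> \<beta> \<le> \<alpha> \<Longrightarrow> dia n \<alpha> \<phi> \<turnstile> dia n \<beta> \<phi>"
| add1: "\<phi> \<in> formulas \<Longrightarrow> dia n (\<alpha> + \<beta>) \<phi> \<turnstile> dia n \<beta> (dia n \<alpha> \<phi>)"
| add2: "\<phi> \<in> formulas \<Longrightarrow> dia n \<beta> (dia n \<alpha> \<phi>) \<turnstile> dia n (\<alpha> + \<beta>) \<phi>"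
| reduce: "\<phi> \<in> formulas \<Longrightarrow> dia (m + n) \<alpha> \<phi> \<turnstile> dia m (hyper_exp n \<alpha>) \<phi>"
| Schmerl1: "mconj ((n\<^sub>0, \<alpha>\<^sub>0) # l) \<in> MNF \<Longrightarrow> 0 < \<alpha>\<^sub>0 \<Longrightarrow> n < n\<^sub>0 \<Longrightarrow>
    dia n \<alpha> (mconj ((n\<^sub>0, \<alpha>\<^sub>0) # l)) \<turnstile>
    Conj (dia n (hyper_exp (n\<^sub>0 - n) \<alpha>\<^sub>0 * (1 + \<alpha>)) Top) (mconj ((n\<^sub>0, \<alpha>\<^sub>0) # l))"
| Schmerl2: "mconj ((n\<^sub>0, \<alpha>\<^sub>0) # l) \<in> MNF \<Longrightarrow> 0 < \<alpha>\<^sub>0 \<Longrightarrow> n < n\<^sub>0 \<Longrightarrow>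
    Conj (dia n (hyper_exp (n\<^sub>0 - n) \<alpha>\<^sub>0 * (1 + \<alpha>)) Top) (mconj ((n\<^sub>0, \<alpha>\<^sub>0) # l)) \<turnstile>
    dia n \<alpha> (mconj ((n\<^sub>0, \<alpha>\<^sub>0) # l))"
| conjI: "\<phi> \<turnstile> \<psi> \<Longrightarrow> \<phi> \<turnstile> \<chi> \<Longrightarrow> \<phi> \<turnstile> Conj \<psi> \<chi>"
| cut: "\<phi> \<turnstile> \<psi> \<Longrightarrow> \<psi> \<turnstile> \<chi> \<Longrightarrow> \<phi> \<turnstile> \<chi>"
| nec: "\<phi> \<turnstile> \<psi> \<Longrightarrow> dia n \<alpha> \<phi> \<turnstile> dia n \<alpha> \<psi>"
| conj_dia: "\<phi> \<turnstile> \<psi> \<Longrightarrow> m < n \<Longrightarrow>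
    Conj (dia n \<alpha> \<phi>) (dia m (\<beta> + 1) \<psi>) \<turnstile> dia n \<alpha> (Conj \<phi> (dia m (\<beta> + 1) \<psi>))"

definition TSC_equiv :: "fm \<Rightarrow> fm \<Rightarrow> bool" where
  "TSC_equiv \<phi> \<psi> \<longleftrightarrow> \<phi> \<turnstile> \<psi> \<and> \<psi> \<turnstile> \<phi>"

end

theory Submission
  imports Defs
begin

text \<open>Read from right to left, a Schmerl axiom turns the leading conjunct
  \<open>\<langle>n\<^sub>0\<^sup>\<alpha>\<rangle>\<top>\<close> with \<open>\<alpha> = e(\<alpha>\<^sub>1) \<cdot> (1 + \<beta>)\<close> of a formula in MNF into the prefix
  \<open>\<langle>n\<^sub>0\<^sup>\<beta>\<rangle>\<close> of the remaining conjunction, so induction on the number of conjuncts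
  yields the worm. The factor \<open>2 + \<gamma>\<close> in the definition of MNF equals \<open>1 + \<beta>\<close> with
  \<open>\<beta> = 1 + \<gamma> > 0\<close>, which puts the worm in INF.\<close>

lemma lsub_eqI: "a + c = b \<Longrightarrow> lsub a b = c"
  by (auto simp: lsub_def)

text \<open>For \<open>d = 0\<close> every product \<open>d * c\<close> is 0, so only a positive
  divisor determines its quotient.\<close>

lemma lquot_eqI: "0 < d \<Longrightarrow> a = d * c \<Longrightarrow> lquot a d = c"
  by (auto simp: lquot_def eps0_times_left_cancel)

text \<open>A positive exponent makes the omega power exceed 1, so removing a 1 on the left leaves
  something positive. This keeps the divisors in the quotients nonzero.\<close>

lemma hyper_exp_pos: "0 < a \<Longrightarrow> 0 < hyper_exp n a"
proof (induction n)
  case (Suc n)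
  let ?b = "hyper_exp n a"
  have "1 < omega_pow ?b" using Suc by (simp flip: omega_pow_0)
  then obtain c where c: "omega_pow ?b = 1 + c" using eps0_le_iff_add less_imp_le by blast
  with \<open>1 < omega_pow ?b\<close> have "0 < c" by (metis add.right_neutral eps0_add_less_cancel)
  then show ?case using c lsub_eqI[of 1 c "omega_pow ?b"] by (simp add: hyper_exp_def)
qed (simp add: hyper_exp_def)

lemma eps0_two_add: "2 + b = 1 + (1 + (b::eps0))"
  by (simp only: one_add_one[symmetric] add.assoc)

text \<open>\<open>dia\<close> erases entries of exponent 0, so \<open>mconj\<close> is not
  injective on lists. A positive exponent survives in the formula, which makes the head readable;
  the tails may still differ.\<close>

lemma mconj_head_unique:
  assumes "0 < a" "mconj ((m, a) # l) = mconj (p # l')"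
  shows "p = (m, a)"
  using assms by (cases p; cases l; cases l') (auto simp: dia_def split: if_splits)

text \<open>Rule inversion only equates formulas, not the lists behind them. Positive exponents
  identify the first two entries; for the rest, equality of the tail formulas suffices.\<close>

lemma MNF_ConsE:
  assumes "mconj ((m, a) # (m', a') # l) \<in> MNF"
  obtains b where "mconj ((m', a') # l) \<in> MNF" "0 < a'" "m < m'"
    "a = hyper_exp (m' - m) a' * (2 + b)"
  using assms
proof (cases rule: MNF.cases)
  case Top
  then show ?thesis by simp
next
  case (monomial x y)
  then show ?thesis by (simp add: dia_def split: if_splits)
next
  case (step m0 a0 l0 x y b)
  have "0 < 2 + b"
    unfolding eps0_two_add by (rule less_le_trans[OF eps0_zero_less_one eps0_le_add])
  \<comment> \<open>Both factors of \<open>y\<close> are positive, as reading off the first entry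
    requires.\<close>
  then have "0 < y" using step by (simp add: hyper_exp_pos eps0_times_pos)
  moreover have "mconj ((x, y) # (m0, a0) # l0) = mconj ((m, a) # (m', a') # l)"
    using step by simp
  ultimately have "(m, a) = (x, y)" by (rule mconj_head_unique)
  moreover have eq: "mconj ((m0, a0) # l0) = mconj ((m', a') # l)" using step by simp
  then have "(m', a') = (m0, a0)" by (rule mconj_head_unique[OF \<open>0 < a0\<close>])
  ultimately show ?thesis using that[of b] step eq by simp
qed

lemma TSC_equiv_trans: "TSC_equiv \<phi> \<psi> \<Longrightarrow> TSC_equiv \<psi> \<chi> \<Longrightarrow> TSC_equiv \<phi> \<chi>"
  unfolding TSC_equiv_def by (blast intro: TSC.cut)

lemma TSC_equiv_dia: "TSC_equiv \<phi> \<psi> \<Longrightarrow> TSC_equiv (dia m a \<phi>) (dia m a \<psi>)"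
  unfolding TSC_equiv_def by (blast intro: TSC.nec)

text \<open>Two conjuncts go beyond the theorem: positivity of the head \<open>\<beta> 0\<close> is
  what prefixing a modality within INF demands of the shorter worm, and positivity of each
  \<open>\<alpha> (Suc i)\<close> later makes the quotients unique. The families are generalized
  because the tail is the family shifted by one.\<close>

lemma MNF_equiv_INF_worm:
  assumes "mconj (map (\<lambda>i. (n i, \<alpha> i)) [0..<Suc k]) \<in> MNF"
  shows "\<exists>\<beta>. worm_of (map (\<lambda>i. (n i, \<beta> i)) [0..<Suc k]) \<in> INF_worms
    \<and> TSC_equiv (mconj (map (\<lambda>i. (n i, \<alpha> i)) [0..<Suc k]))
        (worm_of (map (\<lambda>i. (n i, \<beta> i)) [0..<Suc k]))
    \<and> \<beta> k = \<alpha> k \<and> (0 < \<alpha> 0 \<longrightarrow> 0 < \<beta> 0)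
    \<and> (\<forall>i<k. 0 < \<alpha> (Suc i)
        \<and> \<alpha> i = hyper_exp (n (Suc i) - n i) (\<alpha> (Suc i)) * (1 + \<beta> i))"
  using assms
proof (induction k arbitrary: n \<alpha>)
  case 0
  show ?case
  proof (intro exI[of _ \<alpha>] HOL.conjI)
    \<comment> \<open>If \<open>\<alpha> 0 = 0\<close>, the single conjunct is \<open>Top\<close>
      itself.\<close>
    show "worm_of (map (\<lambda>i. (n i, \<alpha> i)) [0..<Suc 0]) \<in> INF_worms"
      using INF_worms.Top INF_worms.single[of "\<alpha> 0" "n 0"]
      by (cases "\<alpha> 0 = 0") (simp_all add: dia_def order_less_le)
    show "TSC_equiv (mconj (map (\<lambda>i. (n i, \<alpha> i)) [0..<Suc 0]))
        (worm_of (map (\<lambda>i. (n i, \<alpha> i)) [0..<Suc 0]))"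
      by (simp add: TSC_equiv_def TSC.refl formulas.Top formulas.dia)
  qed simp_all
next
  case (Suc k)
  \<comment> \<open>Entries from index 2 on: the inversion and the INF rule need the first two
    entries displayed.\<close>
  define tail where "tail f = map (\<lambda>i. (n i, f i :: eps0)) [Suc (Suc 0)..<Suc (Suc k)]" for f
  have list_Suc: "map (\<lambda>i. (n (Suc i), f (Suc i))) [0..<Suc k] = (n 1, f 1) # tail f"
    for f :: "nat \<Rightarrow> eps0"
  proof -
    have "map (\<lambda>i. (n (Suc i), f (Suc i))) [0..<Suc k]
        = map (\<lambda>i. (n i, f i)) (map Suc [0..<Suc k])"
      by (simp only: map_map comp_def)
    also have "map Suc [0..<Suc k] = Suc 0 # [Suc (Suc 0)..<Suc (Suc k)]"
      unfolding map_Suc_upt by (simp add: upt_conv_Cons del: upt_Suc)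
    finally show ?thesis by (simp add: tail_def del: upt_Suc)
  qed
  have list: "map (\<lambda>i. (n i, f i)) [0..<Suc (Suc k)] = (n 0, f 0) # (n 1, f 1) # tail f"
    for f :: "nat \<Rightarrow> eps0"
    by (simp add: tail_def upt_conv_Cons del: upt_Suc)
  obtain b where MNF: "mconj ((n 1, \<alpha> 1) # tail \<alpha>) \<in> MNF" and pos: "0 < \<alpha> 1"
    and less: "n 0 < n 1" and b: "\<alpha> 0 = hyper_exp (n 1 - n 0) (\<alpha> 1) * (2 + b)"
    using Suc.prems unfolding list by (rule MNF_ConsE)
  obtain \<beta>' where \<beta>':
    "worm_of (map (\<lambda>i. (n (Suc i), \<beta>' i)) [0..<Suc k]) \<in> INF_worms"
    "TSC_equiv (mconj ((n 1, \<alpha> 1) # tail \<alpha>))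
      (worm_of (map (\<lambda>i. (n (Suc i), \<beta>' i)) [0..<Suc k]))"
    "\<beta>' k = \<alpha> (Suc k)" "0 < \<beta>' 0"
    "\<forall>i<k. 0 < \<alpha> (Suc (Suc i)) \<and> \<alpha> (Suc i) =
      hyper_exp (n (Suc (Suc i)) - n (Suc i)) (\<alpha> (Suc (Suc i))) * (1 + \<beta>' i)"
    using Suc.IH[of "\<lambda>i. n (Suc i)" "\<lambda>i. \<alpha> (Suc i)"] MNF pos
    unfolding list_Suc by (auto simp del: upt_Suc)
  \<comment> \<open>The new head \<open>1 + b\<close> comes from \<open>2 + b = 1 + (1 + b)\<close>;
    later exponents are those of the shorter worm, shifted.\<close>
  define \<beta> where "\<beta> = case_nat (1 + b) \<beta>'"
  have \<beta>_simps: "\<beta> 0 = 1 + b" "\<beta> (Suc i) = \<beta>' i" for i by (simp_all add: \<beta>_def)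
  have \<beta>0: "0 < \<beta> 0"
    unfolding \<beta>_simps by (rule less_le_trans[OF eps0_zero_less_one eps0_le_add])
  have \<alpha>0: "\<alpha> 0 = hyper_exp (n 1 - n 0) (\<alpha> 1) * (1 + \<beta> 0)"
    using b by (simp only: \<beta>_simps eps0_two_add)
  have \<beta>'_list: "map (\<lambda>i. (n (Suc i), \<beta>' i)) [0..<Suc k] = (n 1, \<beta> 1) # tail \<beta>"
    using list_Suc[of \<beta>] by (simp add: \<beta>_simps del: upt_Suc)
  have "TSC_equiv (mconj ((n 0, \<alpha> 0) # (n 1, \<alpha> 1) # tail \<alpha>))
      (dia (n 0) (\<beta> 0) (mconj ((n 1, \<alpha> 1) # tail \<alpha>)))"
    using TSC.Schmerl1[OF MNF pos less, of "\<beta> 0"] TSC.Schmerl2[OF MNF pos less, of "\<beta> 0"] \<alpha>0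
    by (simp add: TSC_equiv_def)
  moreover have "TSC_equiv \<dots> (worm_of ((n 0, \<beta> 0) # (n 1, \<beta> 1) # tail \<beta>))"
    using TSC_equiv_dia[OF \<beta>'(2)] unfolding \<beta>'_list by simp
  ultimately have equiv: "TSC_equiv (mconj ((n 0, \<alpha> 0) # (n 1, \<alpha> 1) # tail \<alpha>))
      (worm_of ((n 0, \<beta> 0) # (n 1, \<beta> 1) # tail \<beta>))"
    by (rule TSC_equiv_trans)
  have INF: "worm_of ((n 0, \<beta> 0) # (n 1, \<beta> 1) # tail \<beta>) \<in> INF_worms"
    using INF_worms.step[of "n 1" "\<beta> 1" "worm_of (tail \<beta>)" "\<beta> 0" "n 0"] \<beta>'(1,4) \<beta>0 less
    unfolding \<beta>'_list by (simp add: \<beta>_simps)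
  have "\<forall>i<Suc k. 0 < \<alpha> (Suc i)
      \<and> \<alpha> i = hyper_exp (n (Suc i) - n i) (\<alpha> (Suc i)) * (1 + \<beta> i)"
    using \<alpha>0 pos \<beta>'(5) by (auto simp: All_less_Suc2 \<beta>_simps)
  then show ?case unfolding list using equiv INF \<beta>0 \<beta>'(3)
    by (intro exI[of _ \<beta>]) (simp add: \<beta>_simps)
qed

theorem theorem5p1:
  fixes k :: nat and n :: "nat \<Rightarrow> nat" and \<alpha> :: "nat \<Rightarrow> eps0" and \<psi> :: fm
  assumes "\<psi> = mconj (map (\<lambda>i. (n i, \<alpha> i)) [0..<Suc k])"
    and "\<psi> \<in> MNF"
  shows "\<exists>A \<beta>. A \<in> worms \<and> A \<in> INF_worms \<and> TSC_equiv \<psi> A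
    \<and> A = worm_of (map (\<lambda>i. (n i, \<beta> i)) [0..<Suc k])
    \<and> \<beta> k = \<alpha> k
    \<and> (\<forall>i<k. \<beta> i = lsub 1 (lquot (\<alpha> i) (hyper_exp (n (Suc i) - n i) (\<alpha> (Suc i))))
          \<and> \<alpha> i = hyper_exp (n (Suc i) - n i) (\<alpha> (Suc i)) * (1 + \<beta> i)
          \<and> (\<forall>\<gamma>. \<alpha> i = hyper_exp (n (Suc i) - n i) (\<alpha> (Suc i)) * (1 + \<gamma>) \<longrightarrow> \<gamma> = \<beta> i))"
proof -
  obtain \<beta> where \<beta>: "worm_of (map (\<lambda>i. (n i, \<beta> i)) [0..<Suc k]) \<in> INF_worms"
    "TSC_equiv \<psi> (worm_of (map (\<lambda>i. (n i, \<beta> i)) [0..<Suc k]))" "\<beta> k = \<alpha> k"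
    and factor: "\<And>i. i < k \<Longrightarrow> 0 < \<alpha> (Suc i)
      \<and> \<alpha> i = hyper_exp (n (Suc i) - n i) (\<alpha> (Suc i)) * (1 + \<beta> i)"
    using MNF_equiv_INF_worm[of n \<alpha> k] assms by blast
  have quot: "\<forall>i<k. \<beta> i = lsub 1 (lquot (\<alpha> i) (hyper_exp (n (Suc i) - n i) (\<alpha> (Suc i))))
      \<and> \<alpha> i = hyper_exp (n (Suc i) - n i) (\<alpha> (Suc i)) * (1 + \<beta> i)
      \<and> (\<forall>\<gamma>. \<alpha> i = hyper_exp (n (Suc i) - n i) (\<alpha> (Suc i)) * (1 + \<gamma>) \<longrightarrow> \<gamma> = \<beta> i)"
  proof (intro allI impI)
    fix i assume "i < k"
    let ?d = "hyper_exp (n (Suc i) - n i) (\<alpha> (Suc i))"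
    have d: "0 < ?d" and eq: "\<alpha> i = ?d * (1 + \<beta> i)"
      using factor[OF \<open>i < k\<close>] hyper_exp_pos by auto
    \<comment> \<open>The quotient is exactly \<open>1 + \<beta> i\<close>, and \<open>lsub\<close>
      cancels the leading 1.\<close>
    have "lsub 1 (lquot (\<alpha> i) ?d) = \<beta> i"
      unfolding lquot_eqI[OF d eq] by (rule lsub_eqI) simp
    moreover have "\<gamma> = \<beta> i" if "\<alpha> i = ?d * (1 + \<gamma>)" for \<gamma>
      using that eq eps0_times_left_cancel[OF d] by simp
    ultimately show "\<beta> i = lsub 1 (lquot (\<alpha> i) ?d) \<and> \<alpha> i = ?d * (1 + \<beta> i)
        \<and> (\<forall>\<gamma>. \<alpha> i = ?d * (1 + \<gamma>) \<longrightarrow> \<gamma> = \<beta> i)"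
      using eq[symmetric] by simp
  qed
  have "worm_of (map (\<lambda>i. (n i, \<beta> i)) [0..<Suc k]) \<in> worms"
    unfolding worms_def by (rule rangeI)
  \<comment> \<open>The facts follow the order of the goal's conjuncts; unification with them
    supplies both witnesses.\<close>
  note this \<beta>(1,2) HOL.refl \<beta>(3) quot
  then show ?thesis by (intro exI HOL.conjI)
qed

end
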